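(* A 2-Star Nim position $([a_1],[a_2])$ is a $\mathcal{P}$-position if and only if either $a_1+a_2=1$ or $a_1=a_2\ge 2$.
   Context: $m$-Star Nim: $m$ strips of squares numbered $0,1,2,\ldots$ share their square $0$; each strip carries one token, and the shared square $0$ holds at most one token. A position is a tuple $([a_1],\ldots,[a_m])$ of nonnegative integers with at most one $a_i$ equal to $0$. A move replaces exactly one $a_i$ by a smaller nonnegative integer, provided the result is a legal position (so $a_i$ may be replaced by $0$ only if no other token is on square $0$). The game is impartial and a player unable to move loses. A $\mathcal{P}$-position is one from which the player about to move has no winning strategy; equivalently, its Sprague-Grundy value is $0$. *)

theory Defs
  imports Main
begin

text \<open>An impartial game is given by its move relation. A strategy maps each position to the
  position its owner moves to. The predicate below says that the player about to move at \<open>p\<close>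
  wins by following \<open>s\<close>: the prescribed move exists, and whatever the opponent replies, the player
  again wins by following \<open>s\<close>; in particular, an opponent without a reply has lost. Since
  the definition is inductive, the win occurs after finitely many moves.\<close>

inductive wins_by :: "('p \<Rightarrow> 'p \<Rightarrow> bool) \<Rightarrow> ('p \<Rightarrow> 'p) \<Rightarrow> 'p \<Rightarrow> bool"
  for move :: "'p \<Rightarrow> 'p \<Rightarrow> bool" and s :: "'p \<Rightarrow> 'p"
  where
    "move p (s p) \<Longrightarrow> (\<And>r. move (s p) r \<Longrightarrow> wins_by move s r) \<Longrightarrow> wins_by move s p"

definition P_position :: "('p \<Rightarrow> 'p \<Rightarrow> bool) \<Rightarrow> 'p \<Rightarrow> bool"
  where "P_position move p \<longleftrightarrow> \<not> (\<exists>s. wins_by move s p)"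

text \<open>A position of \<open>m\<close>-Star Nim is the list of the squares occupied by the \<open>m\<close> tokens. All strips
  share square \<open>0\<close>, which holds at most one token; the other squares of each strip are its own.\<close>

definition star_position :: "nat \<Rightarrow> nat list \<Rightarrow> bool"
  where "star_position m a \<longleftrightarrow> length a = m \<and> count_list a 0 \<le> 1"

definition star_move :: "nat \<Rightarrow> nat list \<Rightarrow> nat list \<Rightarrow> bool"
  where "star_move m a b \<longleftrightarrow> star_position m a \<and> star_position m b \<and>
    (\<exists>i<m. \<exists>k<a ! i. b = a[i := k])"

end

theory Submission
  imports Defs
begin

text \<open>Pair square 0 with square 1 and every other square with itself. The claimed P-positions
  are the legal positions whose two tokens stand on paired squares. Each square has exactly one
  partner, so moving a single token always breaks a pairing; from an unpaired legal position the
  pairing can be restored by one move. Such a set is a kernel of the move graph, and in a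
  terminating game the kernel is exactly the set of P-positions
  (\<open>P_position_iff_kernel\<close>). The predicate \<open>L\<close> confines this argument to
  legal positions; termination is \<open>wf_star_move\<close>.\<close>

lemma P_position_iff_kernel:
  assumes wf: "wf {(q, p). move p q}"
    and closed: "\<And>p q. L p \<Longrightarrow> move p q \<Longrightarrow> L q"
    and independent: "\<And>p q. L p \<Longrightarrow> Q p \<Longrightarrow> move p q \<Longrightarrow> \<not> Q q"
    and absorbing: "\<And>p. L p \<Longrightarrow> \<not> Q p \<Longrightarrow> \<exists>q. move p q \<and> Q q"
    and "L p"
  shows "P_position move p \<longleftrightarrow> Q p"
proof
  assume P: "P_position move p"
  \<comment> \<open>The winning strategy is to move into the kernel. Its arbitrary values elsewhere
    are harmless, since play keeps returning to legal positions outside \<open>Q\<close>.\<close>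
  define s where "s = (\<lambda>p. SOME q. move p q \<and> Q q)"
  have s: "move p (s p) \<and> Q (s p)" if "L p" "\<not> Q p" for p
    unfolding s_def by (rule someI_ex) (rule absorbing[OF that])
  have "wins_by move s p" if "L p" "\<not> Q p" for p
    using that
  \<comment> \<open>The induction hypothesis is applied two moves later, after the opponent's reply,
    hence the transitive closure.\<close>
  proof (induction p rule: wf_induct_rule[OF wf_trancl[OF wf]])
    case (1 p)
    note sp = s[OF "1.prems"]
    show ?case
    proof (rule wins_by.intros)
      show "move p (s p)" using sp by blast
    next
      fix r assume r: "move (s p) r"
      have "L (s p)" using closed "1.prems"(1) sp by blast
      then have "L r" "\<not> Q r" using closed independent sp r by blast+
      moreover have "(r, p) \<in> {(q, p). move p q}\<^sup>+"
        using sp r by (auto intro: trancl_into_trancl2)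
      ultimately show "wins_by move s r" using "1.IH" by blast
    qed
  qed
  then show "Q p" using P \<open>L p\<close> unfolding P_position_def by blast
next
  \<comment> \<open>No strategy wins from the kernel: its move leaves \<open>Q\<close>, and the
    opponent can answer back into \<open>Q\<close>, where the induction hypothesis denies that the
    strategy still wins.\<close>
  have "\<not> Q p" if "wins_by move s p" "L p" for s p
    using that
  proof (induction rule: wins_by.induct)
    case (1 p)
    show ?case
    proof
      assume "Q p"
      have "L (s p)" "\<not> Q (s p)"
        using closed[OF "1.prems" "1.hyps"(1)] independent[OF "1.prems" \<open>Q p\<close> "1.hyps"(1)]
        by simp_all
      then obtain r where r: "move (s p) r" "Q r" using absorbing by blast
      then show False using "1.IH"[OF r(1)] closed[OF \<open>L (s p)\<close> r(1)] by simp
    qed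
  qed
  moreover assume "Q p"
  ultimately show "P_position move p"
    using \<open>L p\<close> unfolding P_position_def by blast
qed

text \<open>Every move lowers the sum of the square numbers. The bound on a summand is there because
  \<open>sum_list_update\<close> involves truncated subtraction.\<close>

lemma wf_star_move: "wf {(b, a). star_move m a b}"
proof (rule wf_subset[OF wf_measure[of sum_list]], clarsimp)
  fix a b assume "star_move m a b"
  then obtain i k where "i < length a" "k < a ! i" "b = a[i := k]"
    by (auto simp: star_move_def star_position_def)
  then show "sum_list b < sum_list a"
    using member_le_sum_list[of "a ! i" a] by (simp add: sum_list_update)
qed

lemma star_position_2_iff: "star_position 2 [a, b] \<longleftrightarrow> a \<noteq> 0 \<or> b \<noteq> 0"
  by (auto simp: star_position_def)

lemma star_move_2_iff:
  "star_move 2 [a, b] q \<longleftrightarrow> star_position 2 [a, b] \<and> star_position 2 q \<and>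
    ((\<exists>k<a. q = [k, b]) \<or> (\<exists>k<b. q = [a, k]))"
proof -
  have ex_less_2: "(\<exists>i<2. P i) \<longleftrightarrow> P 0 \<or> P (Suc 0)" for P :: "nat \<Rightarrow> bool"
    by (auto simp: numeral_2_eq_2 less_Suc_eq)
  show ?thesis
    unfolding star_move_def ex_less_2 by simp
qed

theorem proposition1:
  fixes a1 a2 :: nat
  assumes "star_position 2 [a1, a2]"
  shows "P_position (star_move 2) [a1, a2] \<longleftrightarrow> a1 + a2 = 1 \<or> (a1 = a2 \<and> a1 \<ge> 2)"
proof -
  define Q :: "nat list \<Rightarrow> bool"
    where "Q p \<longleftrightarrow> p ! 0 + p ! 1 = 1 \<or> (p ! 0 = p ! 1 \<and> p ! 0 \<ge> 2)" for p
  have "P_position (star_move 2) [a1, a2] \<longleftrightarrow> Q [a1, a2]"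
  proof (rule P_position_iff_kernel[where L = "star_position 2"])
    show "wf {(q, p). star_move 2 p q}" by (rule wf_star_move)
    show "star_position 2 q" if "star_move 2 p q" for p q
      using that by (simp add: star_move_def)
    have pair: "\<exists>a b. p = [a, b]" if "star_position 2 p" for p
      using that by (auto simp: star_position_def numeral_2_eq_2 length_Suc_conv)
    \<comment> \<open>One token stays put and its square has a unique partner, which the other token
      has just left.\<close>
    show "\<not> Q q" if "star_position 2 p" "Q p" "star_move 2 p q" for p q
      using pair[OF that(1)] that(2,3) by (auto simp: star_move_2_iff Q_def)
    show "\<exists>q. star_move 2 p q \<and> Q q" if p: "star_position 2 p" and "\<not> Q p" for p
    proof -
      obtain a b where ab: "p = [a, b]" using pair[OF p] by blast
      \<comment> \<open>Move the larger token to the square that pairs with the smaller one: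
        0 and 1 are paired, every other square is paired with itself.\<close>
      define t where "t = (\<lambda>c::nat. if c \<le> 1 then 1 - c else c)"
      have Q_t: "Q [a, t a]" "Q [t b, b]"
        by (auto simp: Q_def t_def)
      have pos: "a \<noteq> 0 \<or> b \<noteq> 0" using p ab by (simp add: star_position_2_iff)
      \<comment> \<open>Only for a smaller token on 0 does the target \<open>t\<close> lie above it;
        then the other token is not on 0 by legality and not on 1 by \<open>\<not> Q p\<close>, so
        it is beyond 1. A smaller token on 1 has target 0, which also settles the position with both
        tokens on 1.\<close>
      have "a \<le> b \<and> t a < b \<or> b \<le> a \<and> t b < a"
        using \<open>\<not> Q p\<close> pos unfolding ab Q_def t_def by (auto split: if_splits)
      then show ?thesis
      proof (elim disjE conjE)
        assume "t a < b"
        \<comment> \<open>The result is legal because the partner of 0 is 1, so paired tokens never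
          share square 0.\<close>
        then have "star_move 2 p [a, t a]"
          unfolding ab star_move_2_iff by (auto simp: t_def star_position_2_iff)
        then show ?thesis using Q_t by blast
      next
        assume "t b < a"
        then have "star_move 2 p [t b, b]"
          unfolding ab star_move_2_iff by (auto simp: t_def star_position_2_iff)
        then show ?thesis using Q_t by blast
      qed
    qed
  qed (fact assms)
  then show ?thesis by (simp add: Q_def)
qed

end
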